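(* Let $i\in\mathbb{Z}$, let $M_-,M_+\in\mathbb{Z}$ with $M:=M_-+M_+\geq2$, and let $\mathrm{X}_{i-M_-,i+M_+}=\{x_{i-M_-},\dots,x_{i+M_+}\}$ be a stencil of real points $x_{i-M_-}<\cdots<x_{i+M_+}$. Let $K_{\mathrm{s}}\in\{1,\dots,\lceil M/2\rceil\}$ and $k_{\mathrm{s}}\in\{0,\dots,K_{\mathrm{s}}\}$. Then the weight-functions $\sigma_{\mathrm{X}_{i-M_-,i+M_+},K_{\mathrm{s}},k_{\mathrm{s}}}$ of the $K_{\mathrm{s}}$-level representation of the Lagrange interpolating polynomial on $\mathrm{X}_{i-M_-,i+M_+}$ (defined in the context) satisfy $$0\leq\sigma_{\mathrm{X}_{i-M_-,i+M_+},K_{\mathrm{s}},k_{\mathrm{s}}}(x)\leq1\qquad\forall x\in[x_{i-M_-+K_{\mathrm{s}}-1},\,x_{i+M_+-K_{\mathrm{s}}+1}].$$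
   Context: For integers $a\leq b$ and real points $x_a<\cdots<x_b$, write $\mathrm{X}_{a,b}:=\{x_a,\dots,x_b\}$ (a stencil). For a stencil $\mathrm{X}_{i-M_-,i+M_+}$ with $M:=M_-+M_+\geq2$, $K_{\mathrm{s}}\in\{1,\dots,M-1\}$ and $k_{\mathrm{s}}\in\{0,\dots,K_{\mathrm{s}}\}$, define real numbers recursively (for the stencil and likewise for each of its substencils of at least three consecutive points) by $$\beta_{\mathrm{X}_{i-M_-,i+M_+},K_{\mathrm{s}},k_{\mathrm{s}}}:=\begin{cases}\dfrac{1}{x_{i+M_+}-x_{i-M_-}} & K_{\mathrm{s}}=1,\\[2mm] \displaystyle\sum_{\ell_{\mathrm{s}}=\max(0,k_{\mathrm{s}}-1)}^{\min(K_{\mathrm{s}}-1,k_{\mathrm{s}})}\beta_{\mathrm{X}_{i-M_-,i+M_+},K_{\mathrm{s}}-1,\ell_{\mathrm{s}}}\;\beta_{\mathrm{X}_{i-M_-+\ell_{\mathrm{s}},\,i+M_+-(K_{\mathrm{s}}-1)+\ell_{\mathrm{s}}},1,k_{\mathrm{s}}-\ell_{\mathrm{s}}} & K_{\mathrm{s}}\geq2,\end{cases}$$ and the weight-functions $$\sigma_{\mathrm{X}_{i-M_-,i+M_+},K_{\mathrm{s}},k_{\mathrm{s}}}(x):=(-1)^{K_{\mathrm{s}}-k_{\mathrm{s}}}\,\beta_{\mathrm{X}_{i-M_-,i+M_+},K_{\mathrm{s}},k_{\mathrm{s}}}\prod_{x_n\in \mathrm{X}_{i-M_-,i+M_+}\setminus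 \mathrm{X}_{i-M_-+k_{\mathrm{s}},\,i+M_+-K_{\mathrm{s}}+k_{\mathrm{s}}}}(x-x_n).$$ These are the weight-functions for which the Lagrange interpolating polynomial of any $f:\mathbb{R}\to\mathbb{R}$ on $\mathrm{X}_{i-M_-,i+M_+}$ equals $\sum_{k_{\mathrm{s}}=0}^{K_{\mathrm{s}}}\sigma_{\mathrm{X}_{i-M_-,i+M_+},K_{\mathrm{s}},k_{\mathrm{s}}}(x)$ times the Lagrange interpolating polynomial of $f$ on $\mathrm{X}_{i-M_-+k_{\mathrm{s}},\,i+M_+-K_{\mathrm{s}}+k_{\mathrm{s}}}$ (each term of the sum being such a product), with $\sum_{k_{\mathrm{s}}=0}^{K_{\mathrm{s}}}\sigma_{\mathrm{X}_{i-M_-,i+M_+},K_{\mathrm{s}},k_{\mathrm{s}}}(x)=1$ for all $x\in\mathbb{R}$. *)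

theory Defs
  imports Complex_Main
begin

definition stencil :: "(int \<Rightarrow> real) \<Rightarrow> int \<Rightarrow> int \<Rightarrow> real set" where
  "stencil x a b = x ` {a..b}"

text \<open>The stencil \<open>x\<^sub>a < \<dots> < x\<^sub>b\<close> is passed as the family \<open>x\<close> and its two end indices, so that a
  substencil is given by changing the indices. The level is meant to be positive; the value at
  level \<open>0\<close> is arbitrary. In the recursive case, at level \<open>K + 2\<close>, the lower summation bound
  \<open>k - 1\<close> is truncated subtraction, i.e. \<open>max(0, k - 1)\<close>.\<close>

fun beta :: "(int \<Rightarrow> real) \<Rightarrow> int \<Rightarrow> int \<Rightarrow> nat \<Rightarrow> nat \<Rightarrow> real" where
  "beta x a b 0 k = 0"
| "beta x a b (Suc 0) k = 1 / (x b - x a)"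
| "beta x a b (Suc (Suc K)) k =
     (\<Sum>l = k - 1..min (Suc K) k.
        beta x a b (Suc K) l *
        beta x (a + int l) (b - int (Suc K) + int l) (Suc 0) (k - l))"

definition sigma :: "(int \<Rightarrow> real) \<Rightarrow> int \<Rightarrow> int \<Rightarrow> nat \<Rightarrow> nat \<Rightarrow> real \<Rightarrow> real" where
  "sigma x a b K k t =
     (-1) ^ (K - k) * beta x a b K k *
     (\<Prod>y \<in> stencil x a b - stencil x (a + int k) (b - int K + int k). (t - y))"

end

theory Submission
  imports Defs
begin

text \<open>On the given interval the sign \<open>(-1)^(K - k)\<close> cancels the signs of the factors belonging to
  the points removed on the right, and the coefficients \<open>beta\<close> are nonnegative, so every weight is
  nonnegative. Moreover the weights sum to one: passing from level \<open>K\<close> to level \<open>K + 1\<close>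
  splits each weight with the factors \<open>(x\<^sub>q - t) / (x\<^sub>q - x\<^sub>p)\<close> and \<open>(t - x\<^sub>p) / (x\<^sub>q - x\<^sub>p)\<close>,
  where \<open>p\<close> and \<open>q\<close> are the end indices of its substencil, and these two factors add up to one.
  A nonnegative summand of a sum equal to one is at most one.\<close>

text \<open>The summation range of the recursion contains only \<open>k - 1\<close> and
  \<open>k\<close>, and just one of them at the ends \<open>k = 0\<close> and
  \<open>k = Suc K\<close>. The conditionals drop the missing term.\<close>

lemma beta_Suc:
  assumes "1 \<le> K" and "k \<le> Suc K"
  shows "beta x a b (Suc K) k =
    (if k \<le> K then beta x a b K k / (x (b - int K + int k) - x (a + int k)) else 0) +
    (if 1 \<le> k then beta x a b K (k - 1) /
        (x (b - int K + int (k - 1)) - x (a + int (k - 1))) else 0)"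
proof -
  obtain L where L: "K = Suc L"
    using assms(1) by (cases K) auto
  consider "k = 0" | j where "k = Suc j" "j < K" | "k = Suc K"
    using assms(2) by (cases k) (auto simp: le_less)
  then show ?thesis
  proof cases
    case 2
    then have "{k - 1..min (Suc L) k} = {j, Suc j}"
      by (auto simp: L)
    with 2 show ?thesis
      by (simp add: L)
  next
    case 3
    then have "{k - 1..min (Suc L) k} = {K}"
      by (auto simp: L)
    with 3 show ?thesis
      by (simp add: L)
  qed (simp add: L)
qed

text \<open>The removed points are the first \<open>k\<close> and the last \<open>K - k\<close> of
  the stencil, two disjoint blocks since \<open>K\<close> is at most \<open>b - a\<close>. Reversing
  the \<open>K - k\<close> factors on the right produces a second \<open>(-1) ^ (K - k)\<close>,
  which cancels the sign in \<open>sigma\<close>.\<close>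

lemma sigma_eq_beta_prod:
  assumes mono: "strict_mono_on {a..b} x" and k: "k \<le> K" and K: "int K \<le> b - a"
  shows "sigma x a b K k t =
    beta x a b K k * (\<Prod>j<k. t - x (a + int j)) * (\<Prod>j<K - k. x (b - int j) - t)"
proof -
  let ?A = "(\<lambda>j. a + int j) ` {..<k}" and ?B = "(\<lambda>j. b - int j) ` {..<K - k}"
  have inj: "inj_on x {a..b}"
    using mono by (rule strict_mono_on_imp_inj_on)
  have A: "?A = {a..<a + int k}"
  proof (intro equalityI subsetI)
    fix n assume "n \<in> {a..<a + int k}"
    then show "n \<in> ?A" by (intro image_eqI[of _ _ "nat (n - a)"]) auto
  qed auto
  have B: "?B = {b - int K + int k<..b}"
  proof (intro equalityI subsetI)
    fix n assume "n \<in> {b - int K + int k<..b}"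
    then show "n \<in> ?B" using k by (intro image_eqI[of _ _ "nat (b - n)"]) auto
  qed (use k in auto)
  have AB: "?A \<union> ?B = {a..b} - {a + int k..b - int K + int k}" and disj: "?A \<inter> ?B = {}"
    and sub: "?A \<union> ?B \<subseteq> {a..b}"
    unfolding A B using k K by auto
  have "stencil x a b - stencil x (a + int k) (b - int K + int k) = x ` (?A \<union> ?B)"
    unfolding stencil_def AB using k K
    by (intro inj_on_image_set_diff[OF inj, symmetric]) auto
  then have "(\<Prod>y \<in> stencil x a b - stencil x (a + int k) (b - int K + int k). t - y) =
      (\<Prod>n \<in> ?A \<union> ?B. t - x n)"
    using inj_on_subset[OF inj sub] by (simp add: prod.reindex)
  also have "\<dots> = (\<Prod>n \<in> ?A. t - x n) * (\<Prod>n \<in> ?B. t - x n)"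
    using disj by (intro prod.union_disjoint) auto
  also have "\<dots> = (\<Prod>j<k. t - x (a + int j)) * (\<Prod>j<K - k. t - x (b - int j))"
    by (simp add: prod.reindex inj_on_def)
  also have "(\<Prod>j<K - k. t - x (b - int j)) = (\<Prod>j<K - k. (-1) * (x (b - int j) - t))"
    by simp
  also have "\<dots> = (-1) ^ (K - k) * (\<Prod>j<K - k. x (b - int j) - t)"
    by (simp only: prod.distrib prod_constant card_lessThan)
  finally show ?thesis
    by (simp add: sigma_def flip: power_add mult_2)
qed

text \<open>The substencil \<open>k\<close> of level \<open>Suc K\<close> arises in two ways: by
  dropping the right end of substencil \<open>k\<close> of level \<open>K\<close>, or the left end
  of substencil \<open>k - 1\<close>. Each way contributes one term, with the dropped point giving
  the new linear factor.\<close>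

lemma sigma_Suc:
  assumes mono: "strict_mono_on {a..b} x" and "1 \<le> K" and k: "k \<le> Suc K"
    and K: "int (Suc K) \<le> b - a"
  shows "sigma x a b (Suc K) k t =
    (if k \<le> K then sigma x a b K k t *
      ((x (b - int K + int k) - t) / (x (b - int K + int k) - x (a + int k))) else 0) +
    (if 1 \<le> k then sigma x a b K (k - 1) t *
      ((t - x (a + int (k - 1))) /
        (x (b - int K + int (k - 1)) - x (a + int (k - 1)))) else 0)"
proof -
  have right: "(\<Prod>j<Suc K - k. x (b - int j) - t) =
      (\<Prod>j<K - k. x (b - int j) - t) * (x (b - int K + int k) - t)" if "k \<le> K"
    using that by (simp add: Suc_diff_le diff_diff_eq2 add_diff_eq diff_add_eq)
  have left: "(\<Prod>j<k. t - x (a + int j)) =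
      (\<Prod>j<k - 1. t - x (a + int j)) * (t - x (a + int (k - 1)))" if "1 \<le> k"
    using that by (cases k) simp_all
  have sigmas: "sigma x a b (Suc K) k t = beta x a b (Suc K) k *
        (\<Prod>j<k. t - x (a + int j)) * (\<Prod>j<Suc K - k. x (b - int j) - t)"
    "k \<le> K \<Longrightarrow> sigma x a b K k t = beta x a b K k *
        (\<Prod>j<k. t - x (a + int j)) * (\<Prod>j<K - k. x (b - int j) - t)"
    "1 \<le> k \<Longrightarrow> sigma x a b K (k - 1) t = beta x a b K (k - 1) *
        (\<Prod>j<k - 1. t - x (a + int j)) * (\<Prod>j<Suc K - k. x (b - int j) - t)"
    using k K by (simp_all add: sigma_eq_beta_prod[OF mono])
  consider "k = 0" | "1 \<le> k" "k \<le> K" | "k = Suc K"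
    using k by linarith
  then show ?thesis
  proof cases
    case 1
    then show ?thesis
      using sigmas(1,2) right beta_Suc[OF assms(2) k] by simp
  next
    case 2
    \<comment> \<open>Here \<open>l\<close> and \<open>r\<close> stand for the innermost left and
      right factors, \<open>A\<close> and \<open>B\<close> for the remaining products.\<close>
    have "(p / d + q / e) * (A * l) * (B * r) = p * (A * l) * B * (r / d) + q * A * (B * r) * (l / e)"
      for p d q e A l B r :: real
      by (simp add: algebra_simps)
    then show ?thesis
      using 2 by (simp only: sigmas right left beta_Suc[OF assms(2) k] if_True)
  next
    case 3
    then show ?thesis
      using sigmas(1,3) left beta_Suc[OF assms(2) k] by simp
  qed
qed

lemma beta_nonneg:
  assumes mono: "strict_mono_on {a..b} x" and "int K \<le> b - a" and "k \<le> K"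
  shows "0 \<le> beta x a b K k"
  using assms(2,3)
proof (induction K arbitrary: k)
  case (Suc K)
  have gap: "0 \<le> x (b - int K + int l) - x (a + int l)" if "l \<le> K" for l
    using strict_mono_onD[OF mono, of "a + int l" "b - int K + int l"] that Suc.prems
    by simp
  show ?case
  \<comment> \<open>Level one is read off the definition, because \<open>beta_Suc\<close> starts
    from a level of at least one.\<close>
  proof (cases "K = 0")
    case True
    then show ?thesis using gap[of 0] by simp
  next
    case False
    then have "beta x a b (Suc K) k =
      (if k \<le> K then beta x a b K k / (x (b - int K + int k) - x (a + int k)) else 0) +
      (if 1 \<le> k then beta x a b K (k - 1) /
        (x (b - int K + int (k - 1)) - x (a + int (k - 1))) else 0)"
      using Suc.prems by (intro beta_Suc) auto
    also have "\<dots> \<ge> 0"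
    proof (intro add_nonneg_nonneg)
      show "0 \<le> (if k \<le> K then beta x a b K k / (x (b - int K + int k) - x (a + int k)) else 0)"
        using Suc.IH[of k] gap[of k] Suc.prems by simp
      show "0 \<le> (if 1 \<le> k then beta x a b K (k - 1) /
          (x (b - int K + int (k - 1)) - x (a + int (k - 1))) else 0)"
        using Suc.IH[of "k - 1"] gap[of "k - 1"] Suc.prems
        by (simp only: split: if_split) (auto intro!: divide_nonneg_nonneg)
    qed
    finally show ?thesis .
  qed
qed simp

text \<open>The induction starts at level one, where the two weights are those of linear
  interpolation between the end points; level zero has the dummy value \<open>0\<close>.\<close>

lemma sum_sigma:
  assumes mono: "strict_mono_on {a..b} x" and "1 \<le> K" and "int K \<le> b - a"
  shows "(\<Sum>k\<le>K. sigma x a b K k t) = 1"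
  using assms(2,3)
proof (induction K rule: nat_induct_at_least)
  case base
  then have "x a < x b"
    using strict_mono_onD[OF mono, of a b] by simp
  then show ?case
    using base by (simp add: sigma_eq_beta_prod[OF mono] flip: add_divide_distrib)
next
  case (Suc K)
  \<comment> \<open>The weight \<open>k\<close> of level \<open>K\<close> splits into
    \<open>u k\<close>, which goes to index \<open>k\<close> of the next level, and
    \<open>v k\<close>, which goes to index \<open>k + 1\<close>.\<close>
  define u where "u k = sigma x a b K k t *
    ((x (b - int K + int k) - t) / (x (b - int K + int k) - x (a + int k)))" for k
  define v where "v k = sigma x a b K k t *
    ((t - x (a + int k)) / (x (b - int K + int k) - x (a + int k)))" for k
  have "(\<Sum>k\<le>Suc K. sigma x a b (Suc K) k t) =
      (\<Sum>k\<le>Suc K. (if k \<le> K then u k else 0) + (if 1 \<le> k then v (k - 1) else 0))"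
    unfolding u_def v_def using Suc by (intro sum.cong refl sigma_Suc[OF mono]) auto
  also have "\<dots> = (\<Sum>k\<le>Suc K. if k \<le> K then u k else 0) +
      (\<Sum>k\<le>Suc K. if 1 \<le> k then v (k - 1) else 0)"
    by (rule sum.distrib)
  also have "(\<Sum>k\<le>Suc K. if k \<le> K then u k else 0) = (\<Sum>k\<le>K. u k)"
    by simp
  also have "(\<Sum>k\<le>Suc K. if 1 \<le> k then v (k - 1) else 0) = (\<Sum>k\<le>K. v k)"
    by (simp add: sum.atMost_Suc_shift del: sum.atMost_Suc)
  also have "(\<Sum>k\<le>K. u k) + (\<Sum>k\<le>K. v k) = (\<Sum>k\<le>K. sigma x a b K k t)"
    unfolding sum.distrib[symmetric]
  proof (intro sum.cong refl)
    fix k assume "k \<in> {..K}"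
    then have "x (a + int k) < x (b - int K + int k)"
      using strict_mono_onD[OF mono, of "a + int k" "b - int K + int k"] Suc.prems by simp
    then show "u k + v k = sigma x a b K k t"
      by (simp add: u_def v_def flip: distrib_left add_divide_distrib)
  qed
  also have "\<dots> = 1"
    using Suc by simp
  finally show ?case .
qed

text \<open>Whatever \<open>k\<close> is, points removed on the left have index at most
  \<open>a + K - 1\<close> and points removed on the right at least \<open>b - K + 1\<close>. Hence
  one interval serves all \<open>k\<close>, as the comparison with the full sum requires.\<close>

lemma sigma_nonneg:
  assumes mono: "strict_mono_on {a..b} x" and k: "k \<le> K" and K: "int K \<le> b - a"
    and t: "t \<in> {x (a + int K - 1)..x (b - int K + 1)}"
  shows "0 \<le> sigma x a b K k t"
proof -
  have le: "x p \<le> x q" if "a \<le> p" "p \<le> q" "q \<le> b" for p q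
    using strict_mono_on_leD[OF mono, of p q] that by simp
  have "0 \<le> t - x (a + int j)" if "j < k" for j
    using le[of "a + int j" "a + int K - 1"] that k K t by simp
  moreover have "0 \<le> x (b - int j) - t" if "j < K - k" for j
  proof -
    have "int j + 1 \<le> int K"
      using that by linarith
    then show ?thesis
      using le[of "b - int K + 1" "b - int j"] K t by simp
  qed
  ultimately show ?thesis
    unfolding sigma_eq_beta_prod[OF mono k K]
    using beta_nonneg[OF mono K k] by (intro mult_nonneg_nonneg prod_nonneg) auto
qed

theorem proposition3p2:
  fixes i M_minus M_plus M :: int
    and x :: "int \<Rightarrow> real"
    and K k :: nat
    and t :: real
  assumes "M = M_minus + M_plus" and "M \<ge> 2"
    and "strict_mono_on {i - M_minus..i + M_plus} x"
    and "1 \<le> K" and "int K \<le> \<lceil>real_of_int M / 2\<rceil>"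
    and "k \<le> K"
    and "t \<in> {x (i - M_minus + int K - 1)..x (i + M_plus - int K + 1)}"
  shows "0 \<le> sigma x (i - M_minus) (i + M_plus) K k t \<and>
         sigma x (i - M_minus) (i + M_plus) K k t \<le> 1"
proof -
  have "\<lceil>real_of_int M / 2\<rceil> \<le> M"
    using assms(2) by (simp add: ceiling_le_iff)
  then have K: "int K \<le> (i + M_plus) - (i - M_minus)"
    using assms(1,5) by simp
  have nonneg: "0 \<le> sigma x (i - M_minus) (i + M_plus) K l t" if "l \<le> K" for l
    using sigma_nonneg[OF assms(3) that K assms(7)] .
  have "sigma x (i - M_minus) (i + M_plus) K k t \<le>
      (\<Sum>l\<le>K. sigma x (i - M_minus) (i + M_plus) K l t)"
    using nonneg assms(6) by (intro member_le_sum) auto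
  then show ?thesis
    using nonneg[OF assms(6)] sum_sigma[OF assms(3,4) K] by simp
qed

end
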